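(* Let $A$ be a Banach algebra and $B$ a Banach space. (1) Suppose that $B$ is a left Banach $A$-module with action $\pi_\ell:A\times B\to B$, and let $b'\in B^*$. Then $b'\in wap_\ell(B)$ if and only if the adjoint $B^{**}\to A^*$ of the mapping $\pi_\ell^*(b',\cdot):A\to B^*$ is weak$^*$-to-weak continuous. (2) Suppose that $B$ is a right Banach $A$-module with action $\pi_r:B\times A\to B$, and let $b'\in B^*$. Then $b'\in wap_r(B)$ if and only if the adjoint $A^{**}\to B^*$ of the mapping $\pi_r^*(b',\cdot):B\to A^*$ is weak$^*$-to-weak continuous.
   Context: For a bounded bilinear map $m:X\times Y\to Z$ of normed spaces, $m^*:Z^*\times X\to Y^*$ is defined by $\langle m^*(z',x),y\rangle=\langle z',m(x,y)\rangle$. Thus $\langle\pi_\ell^*(b',a),b\rangle=\langle b',\pi_\ell(a,b)\rangle$ and $\langle\pi_r^*(b',b),a\rangle=\langle b',\pi_r(b,a)\rangle$. For a left Banach $A$-module $B$, $wap_\ell(B)$ is the set of $b'\in B^*$ such that $\{\pi_\ell^*(b',a):a\in A,\|a\|\le1\}$ is relatively weakly compact in $B^*$. For a right Banach $A$-module $B$, $wap_r(B)$ is the set of $b'\in B^*$ such that $\{\pi_r^*(b',b):b\in B,\|b\|\le1\}$ is relatively weakly compact in $A^*$. "Weak$^*$-to-weak continuous" means continuous from the weak$^*$ topology of the domain ($\sigma(B^{**},B^* )$, resp. $\sigma(A^{**},A^* )$) to the weak topology of the target ($\sigma(A^*,A^{**})$, resp. $\sigma(B^*,B^{**})$). *)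

theory Defs
  imports "HOL-Analysis.Analysis"
begin

text \<open>
  The scalar field is a type \<open>'k :: {real_normed_field, euclidean_space}\<close>. Both \<open>real\<close> and
  \<open>complex\<close> are instances, and up to isometric isomorphism they are the only ones (a commutative
  finite-dimensional real division algebra is R or C), so real and complex spaces are treated
  at the same time. A space over \<open>'k\<close> is a real normed space together with a scalar
  multiplication by \<open>'k\<close> that extends the real one. Completeness is expressed by the class \<open>banach\<close>.
\<close>

locale normed_space_over = vector_space scale
  for scale :: "'k::{real_normed_field, euclidean_space} \<Rightarrow> 'v::real_normed_vector \<Rightarrow> 'v" +
  assumes scale_of_real: "scale (of_real r) x = r *\<^sub>R x"
    and norm_scale: "norm (scale c x) = norm c * norm x"

locale normed_algebra_over = normed_space_over scale
  for scale :: "'k::{real_normed_field, euclidean_space} \<Rightarrow> 'a::real_normed_algebra \<Rightarrow> 'a" +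
  assumes scale_mult_left: "scale c x * y = scale c (x * y)"
    and scale_mult_right: "x * scale c y = scale c (x * y)"

definition bounded_bilinear_over ::
    "('k::{real_normed_field, euclidean_space} \<Rightarrow> 'x::real_normed_vector \<Rightarrow> 'x)
     \<Rightarrow> ('k \<Rightarrow> 'y::real_normed_vector \<Rightarrow> 'y) \<Rightarrow> ('k \<Rightarrow> 'z::real_normed_vector \<Rightarrow> 'z)
     \<Rightarrow> ('x \<Rightarrow> 'y \<Rightarrow> 'z) \<Rightarrow> bool" where
  "bounded_bilinear_over sX sY sZ m \<longleftrightarrow>
     bounded_bilinear m \<and>
     (\<forall>c x y. m (sX c x) y = sZ c (m x y)) \<and> (\<forall>c x y. m x (sY c y) = sZ c (m x y))"

text \<open>Module actions are bounded but not assumed contractive, and nothing is assumed to be unital.\<close>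

locale left_banach_module =
  A: normed_algebra_over sA + B: normed_space_over sB
  for sA :: "'k::{real_normed_field, euclidean_space} \<Rightarrow> 'a::{real_normed_algebra, banach} \<Rightarrow> 'a"
    and sB :: "'k \<Rightarrow> 'b::banach \<Rightarrow> 'b" +
  fixes action :: "'a \<Rightarrow> 'b \<Rightarrow> 'b"
  assumes bilinear_action: "bounded_bilinear_over sA sB sB action"
    and action_assoc: "action (x * y) b = action x (action y b)"

locale right_banach_module =
  A: normed_algebra_over sA + B: normed_space_over sB
  for sA :: "'k::{real_normed_field, euclidean_space} \<Rightarrow> 'a::{real_normed_algebra, banach} \<Rightarrow> 'a"
    and sB :: "'k \<Rightarrow> 'b::banach \<Rightarrow> 'b" +
  fixes action :: "'b \<Rightarrow> 'a \<Rightarrow> 'b"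
  assumes bilinear_action: "bounded_bilinear_over sB sA sB action"
    and action_assoc: "action b (x * y) = action (action b x) y"

text \<open>
  The dual is a set of functions, normed by \<open>onorm\<close>. An element of the bidual is a function
  on the dual; since HOL functions are total, it is required to be \<open>undefined\<close> off the dual.
\<close>

definition dual ::
    "('k::{real_normed_field, euclidean_space} \<Rightarrow> 'v::real_normed_vector \<Rightarrow> 'v) \<Rightarrow> ('v \<Rightarrow> 'k) set"
  where "dual s = {f. bounded_linear f \<and> (\<forall>c x. f (s c x) = c * f x)}"

definition bidual ::
    "('k::{real_normed_field, euclidean_space} \<Rightarrow> 'v::real_normed_vector \<Rightarrow> 'v)
     \<Rightarrow> (('v \<Rightarrow> 'k) \<Rightarrow> 'k) set" where
  "bidual s = {\<Phi> \<in> extensional (dual s).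
     (\<forall>f\<in>dual s. \<forall>g\<in>dual s. \<Phi> (\<lambda>x. f x + g x) = \<Phi> f + \<Phi> g) \<and>
     (\<forall>c. \<forall>f\<in>dual s. \<Phi> (\<lambda>x. c * f x) = c * \<Phi> f) \<and>
     (\<exists>K. \<forall>f\<in>dual s. norm (\<Phi> f) \<le> K * onorm f)}"

text \<open>\<open>pairing_topology E F p\<close> is the topology \<open>\<sigma>(E, F)\<close>: the coarsest topology on \<open>E\<close> making
  \<open>\<lambda>x. p x f\<close> continuous for all \<open>f \<in> F\<close>.\<close>

definition pairing_topology ::
    "'e set \<Rightarrow> 'f set \<Rightarrow> ('e \<Rightarrow> 'f \<Rightarrow> 'k::topological_space) \<Rightarrow> 'e topology" where
  "pairing_topology E F p =
     pullback_topology E (\<lambda>x. \<lambda>f\<in>F. p x f) (product_topology (\<lambda>_. euclidean) F)"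

lemma topspace_pairing_topology: "topspace (pairing_topology E F p) = E"
  by (auto simp: pairing_topology_def topspace_pullback_topology)

lemma continuous_map_into_pairing_topology:
  "continuous_map T (pairing_topology E F p) h \<longleftrightarrow>
     h ` topspace T \<subseteq> E \<and> (\<forall>f\<in>F. continuous_map T euclidean (\<lambda>x. p (h x) f))"
proof
  assume h: "continuous_map T (pairing_topology E F p) h"
  have "continuous_map (pairing_topology E F p) euclidean (\<lambda>x. p x f)" if "f \<in> F" for f
  proof -
    have "continuous_map (pairing_topology E F p) euclidean ((\<lambda>u. u f) \<circ> (\<lambda>x. \<lambda>f\<in>F. p x f))"
      unfolding pairing_topology_def
      by (intro continuous_map_pullback continuous_map_product_projection that)
    with that show ?thesis by (simp add: o_def)
  qed
  with h show "h ` topspace T \<subseteq> E \<and> (\<forall>f\<in>F. continuous_map T euclidean (\<lambda>x. p (h x) f))"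
    using continuous_map_compose[OF h] continuous_map_image_subset_topspace[OF h]
    by (auto simp: topspace_pairing_topology o_def)
next
  assume "h ` topspace T \<subseteq> E \<and> (\<forall>f\<in>F. continuous_map T euclidean (\<lambda>x. p (h x) f))"
  then show "continuous_map T (pairing_topology E F p) h"
    unfolding pairing_topology_def
    by (intro continuous_map_pullback')
       (auto simp: o_def continuous_map_componentwise)
qed

definition weak_dual_topology ::
    "('k::{real_normed_field, euclidean_space} \<Rightarrow> 'v::real_normed_vector \<Rightarrow> 'v)
     \<Rightarrow> ('v \<Rightarrow> 'k) topology" where
  "weak_dual_topology s = pairing_topology (dual s) (bidual s) (\<lambda>f \<Phi>. \<Phi> f)"

definition weak_star_bidual_topology ::
    "('k::{real_normed_field, euclidean_space} \<Rightarrow> 'v::real_normed_vector \<Rightarrow> 'v)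
     \<Rightarrow> (('v \<Rightarrow> 'k) \<Rightarrow> 'k) topology" where
  "weak_star_bidual_topology s = pairing_topology (bidual s) (dual s) (\<lambda>\<Phi> f. \<Phi> f)"

definition relatively_compactin :: "'e topology \<Rightarrow> 'e set \<Rightarrow> bool" where
  "relatively_compactin T S \<longleftrightarrow> S \<subseteq> topspace T \<and> compactin T (T closure_of S)"

text \<open>\<open>bilinear_adjoint m\<close> is the map \<open>m\<^sup>* : Z\<^sup>* \<times> X \<rightarrow> Y\<^sup>*\<close> of a bounded bilinear
  \<open>m : X \<times> Y \<rightarrow> Z\<close>.\<close>

definition bilinear_adjoint :: "('x \<Rightarrow> 'y \<Rightarrow> 'z) \<Rightarrow> ('z \<Rightarrow> 'k) \<Rightarrow> 'x \<Rightarrow> 'y \<Rightarrow> 'k" where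
  "bilinear_adjoint m z' x = (\<lambda>y. z' (m x y))"

lemma bilinear_adjoint_in_dual:
  assumes "bounded_bilinear_over sX sY sZ m" "z' \<in> dual sZ"
  shows "bilinear_adjoint m z' x \<in> dual sY"
  using assms bounded_linear_compose[of z' "m x"] bounded_bilinear.bounded_linear_right[of m x]
  by (auto simp: bilinear_adjoint_def dual_def bounded_bilinear_over_def)

text \<open>\<open>adjoint_to_dual T\<close> is the adjoint \<open>Y\<^sup>*\<^sup>* \<rightarrow> X\<^sup>*\<close> of a bounded linear \<open>T : X \<rightarrow> Y\<^sup>*\<close>.\<close>

definition adjoint_to_dual :: "('x \<Rightarrow> 'y \<Rightarrow> 'k) \<Rightarrow> (('y \<Rightarrow> 'k) \<Rightarrow> 'k) \<Rightarrow> 'x \<Rightarrow> 'k" where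
  "adjoint_to_dual T \<Phi> = (\<lambda>x. \<Phi> (T x))"

lemma adjoint_to_dual_in_dual:
  assumes m: "bounded_bilinear_over sX sY sZ m" and z': "z' \<in> dual sZ" and \<Phi>: "\<Phi> \<in> bidual sY"
  shows "adjoint_to_dual (bilinear_adjoint m z') \<Phi> \<in> dual sX"
proof -
  let ?T = "bilinear_adjoint m z'"
  have T: "?T x \<in> dual sY" for x
    using bilinear_adjoint_in_dual[OF m z'] .
  have bm: "bounded_bilinear m" and bz: "bounded_linear z'"
    using m z' by (auto simp: bounded_bilinear_over_def dual_def)
  interpret m: bounded_bilinear m by (rule bm)
  interpret z: bounded_linear z' by (rule bz)
  have T_add: "?T (x + y) = (\<lambda>u. ?T x u + ?T y u)" for x y
    by (auto simp: bilinear_adjoint_def m.add_left z.add)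
  have T_scale: "?T (sX c x) = (\<lambda>u. c * ?T x u)" for c x
    using m z' by (auto simp: bilinear_adjoint_def bounded_bilinear_over_def dual_def)
  have T_scaleR: "?T (r *\<^sub>R x) = (\<lambda>u. of_real r * ?T x u)" for r x
    by (auto simp: bilinear_adjoint_def m.scaleR_left z.scaleR scaleR_conv_of_real)
  obtain M where M: "\<And>x y. norm (m x y) \<le> norm x * norm y * M" "0 \<le> M"
    using m.nonneg_bounded by blast
  obtain L where L: "\<And>w. norm (z' w) \<le> norm w * L" "0 \<le> L"
    using z.nonneg_bounded by blast
  obtain K where K: "\<And>f. f \<in> dual sY \<Longrightarrow> norm (\<Phi> f) \<le> K * onorm f"
    using \<Phi> unfolding bidual_def by blast
  have on: "onorm (?T x) \<le> norm x * (M * L)" for x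
  proof (rule onorm_bound)
    show "0 \<le> norm x * (M * L)" using M(2) L(2) by simp
    show "norm (?T x u) \<le> norm x * (M * L) * norm u" for u
      using order_trans[OF L(1)[of "m x u"] mult_right_mono[OF M(1)[of x u] L(2)]]
      by (simp add: bilinear_adjoint_def mult_ac)
  qed
  have "norm (\<Phi> (?T x)) \<le> norm x * (\<bar>K\<bar> * (M * L))" for x
  proof -
    have "0 \<le> onorm (?T x)" using T by (auto simp: dual_def intro: onorm_pos_le)
    then have "K * onorm (?T x) \<le> \<bar>K\<bar> * onorm (?T x)" by (intro mult_right_mono) auto
    also have "\<dots> \<le> \<bar>K\<bar> * (norm x * (M * L))" by (intro mult_left_mono on) auto
    finally show ?thesis using K[OF T, of x] by (simp add: mult_ac)
  qed
  moreover have "\<Phi> (?T (x + y)) = \<Phi> (?T x) + \<Phi> (?T y)" for x y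
    using \<Phi> T by (simp add: T_add bidual_def)
  moreover have "\<Phi> (?T (sX c x)) = c * \<Phi> (?T x)" for c x
    using \<Phi> T by (simp add: T_scale bidual_def)
  moreover have "\<Phi> (?T (r *\<^sub>R x)) = r *\<^sub>R \<Phi> (?T x)" for r x
    using \<Phi> T by (simp add: T_scaleR bidual_def scaleR_conv_of_real)
  ultimately show ?thesis
    by (auto simp: dual_def adjoint_to_dual_def intro!: bounded_linear_intro)
qed

definition wap_left ::
    "('k::{real_normed_field, euclidean_space} \<Rightarrow> 'b::real_normed_vector \<Rightarrow> 'b)
     \<Rightarrow> ('a::real_normed_vector \<Rightarrow> 'b \<Rightarrow> 'b) \<Rightarrow> ('b \<Rightarrow> 'k) set" where
  "wap_left sB \<pi> = {b' \<in> dual sB.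
     relatively_compactin (weak_dual_topology sB) (bilinear_adjoint \<pi> b' ` {a. norm a \<le> 1})}"

definition wap_right ::
    "('k::{real_normed_field, euclidean_space} \<Rightarrow> 'a::real_normed_vector \<Rightarrow> 'a)
     \<Rightarrow> ('k \<Rightarrow> 'b::real_normed_vector \<Rightarrow> 'b)
     \<Rightarrow> ('b \<Rightarrow> 'a \<Rightarrow> 'b) \<Rightarrow> ('b \<Rightarrow> 'k) set" where
  "wap_right sA sB \<pi> = {b' \<in> dual sB.
     relatively_compactin (weak_dual_topology sA) (bilinear_adjoint \<pi> b' ` {b. norm b \<le> 1})}"

lemma normed_algebra_over_real:
  "normed_algebra_over ((*\<^sub>R) :: real \<Rightarrow> 'a::real_normed_algebra \<Rightarrow> 'a)"
  by unfold_locales (auto simp: algebra_simps)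

lemma normed_algebra_over_complex: "normed_algebra_over ((*) :: complex \<Rightarrow> complex \<Rightarrow> complex)"
  by unfold_locales (auto simp: algebra_simps norm_mult scaleR_conv_of_real)

end

theory Submission
  imports Defs
begin

text \<open>
  Both parts are instances of Gantmacher's theorem: a bounded operator \<open>T : X \<rightarrow> Y\<^sup>*\<close> is weakly
  compact if and only if its adjoint \<open>A : Y\<^sup>*\<^sup>* \<rightarrow> X\<^sup>*\<close>, \<open>A \<Phi> = \<Phi> \<circ> T\<close>, is weak-star-to-weak
  continuous. Here \<open>T x = m\<^sup>*(z', x)\<close> for a bounded bilinear \<open>m : X \<times> Y \<rightarrow> Z\<close>, and the two parts
  take \<open>m\<close> to be the left, respectively the right, module action.

  Both properties say that the second adjoint of \<open>T\<close> maps \<open>X\<^sup>*\<^sup>*\<close> into \<open>Y\<^sup>*\<close>: for each \<open>\<Xi>\<close> in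
  \<open>X\<^sup>*\<^sup>*\<close> there is an \<open>f\<close> in \<open>Y\<^sup>*\<close> that represents \<open>\<Xi> \<circ> A\<close>, that is, \<open>\<Xi> (A \<Phi>) = \<Phi> f\<close> for all \<open>\<Phi>\<close>.

  \<^item> Continuity of \<open>A\<close> means that each \<open>\<Xi> \<circ> A\<close> is weak-star continuous, and the weak-star continuous
    functionals on \<open>Y\<^sup>*\<^sup>*\<close> are the evaluations at elements of \<open>Y\<^sup>*\<close>
    (\<open>weak_star_continuous_functional_is_evaluation\<close>).

  \<^item> If \<open>T\<close> is weakly compact and \<open>\<Xi>\<close> is in the unit ball, Goldstine's theorem (\<open>goldstine\<close>) gives, for
    finitely many \<open>\<Phi>\<close> at a time, a point \<open>x\<close> of the ball of \<open>X\<close> for which \<open>\<Phi> (T x) = (A \<Phi>) x\<close> is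
    close to \<open>\<Xi> (A \<Phi>)\<close>. By weak compactness of the closure of the image of the ball, a single
    \<open>f\<close> in it satisfies all these conditions exactly.

  \<^item> Conversely, the representing map \<open>\<Xi> \<mapsto> f\<close> is weak-star-to-weak continuous, because each
    \<open>\<Xi> \<mapsto> \<Xi> (A \<Phi>)\<close> is an evaluation. It sends the ball of \<open>X\<^sup>*\<^sup>*\<close>, which is compact
    (\<open>compactin_bidual_ball\<close>), to a weakly compact set that contains the image under \<open>T\<close> of the
    ball of \<open>X\<close>.
\<close>

section \<open>The dual and the bidual\<close>

lemma dual_lincomb:
  assumes "finite I" "\<And>i. i \<in> I \<Longrightarrow> \<phi> i \<in> dual s"
  shows "(\<lambda>x. \<Sum>i\<in>I. c i * \<phi> i x) \<in> dual s"
proof -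
  have "bounded_linear (\<lambda>x. \<Sum>i\<in>I. c i * \<phi> i x)"
    using assms(2) by (intro bounded_linear_sum bounded_linear_mult_const
        bounded_linear_compose[OF bounded_linear_mult_right]) (auto simp: dual_def)
  then show ?thesis
    using assms(2) by (auto simp: dual_def sum_distrib_left intro!: sum.cong)
qed

lemma dual_cmult: "f \<in> dual s \<Longrightarrow> (\<lambda>x. c * f x) \<in> dual s"
  using dual_lincomb[of "{()}" "\<lambda>_. f" s "\<lambda>_. c"] by simp

lemma dual_add: "f \<in> dual s \<Longrightarrow> g \<in> dual s \<Longrightarrow> (\<lambda>x. f x + g x) \<in> dual s"
  using dual_lincomb[of "{True, False}" "\<lambda>b. if b then f else g" s "\<lambda>_. 1"] by simp

lemma bidual_add:
  "\<Phi> \<in> bidual s \<Longrightarrow> f \<in> dual s \<Longrightarrow> g \<in> dual s \<Longrightarrow> \<Phi> (\<lambda>x. f x + g x) = \<Phi> f + \<Phi> g"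
  by (simp add: bidual_def)

lemma bidual_cmult: "\<Phi> \<in> bidual s \<Longrightarrow> f \<in> dual s \<Longrightarrow> \<Phi> (\<lambda>x. c * f x) = c * \<Phi> f"
  by (simp add: bidual_def)

lemma bidual_lincomb:
  assumes \<Phi>: "\<Phi> \<in> bidual s" and "finite I" and "\<And>i. i \<in> I \<Longrightarrow> \<phi> i \<in> dual s"
  shows "\<Phi> (\<lambda>x. \<Sum>i\<in>I. c i * \<phi> i x) = (\<Sum>i\<in>I. c i * \<Phi> (\<phi> i))"
  using assms(2,3)
proof (induction I rule: finite_induct)
  case empty
  have "(\<lambda>x. 0) \<in> dual s" using dual_lincomb[of "{}" "\<lambda>_. undefined" s] by simp
  then show ?case using bidual_cmult[OF \<Phi>, of "\<lambda>x. 0" 0] by simp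
next
  case (insert i I)
  then show ?case
    using bidual_add[OF \<Phi> dual_cmult[of "\<phi> i" s "c i"] dual_lincomb[of I \<phi> s c]]
    by (simp add: bidual_cmult[OF \<Phi>])
qed

text \<open>Outside the dual, the difference has to take the value \<open>undefined\<close> again.\<close>

lemma bidual_diff_cmult:
  assumes "\<Phi> \<in> bidual s" "\<Psi> \<in> bidual s"
  shows "(\<lambda>f\<in>dual s. \<Phi> f - c * \<Psi> f) \<in> bidual s"
proof -
  obtain K where K: "\<And>f. f \<in> dual s \<Longrightarrow> norm (\<Phi> f) \<le> K * onorm f"
    using assms(1) unfolding bidual_def by blast
  obtain L where L: "\<And>f. f \<in> dual s \<Longrightarrow> norm (\<Psi> f) \<le> L * onorm f"
    using assms(2) unfolding bidual_def by blast
  have "norm (\<Phi> f - c * \<Psi> f) \<le> (K + norm c * L) * onorm f" if "f \<in> dual s" for f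
  proof -
    have "norm (\<Phi> f - c * \<Psi> f) \<le> norm (\<Phi> f) + norm (c * \<Psi> f)" by (rule norm_triangle_ineq4)
    also have "\<dots> \<le> K * onorm f + norm c * (L * onorm f)"
      using K[OF that] mult_left_mono[OF L[OF that], of "norm c"] by (simp add: norm_mult)
    finally show ?thesis by (simp add: algebra_simps)
  qed
  then show ?thesis
    using assms
    by (auto simp: bidual_def dual_add dual_cmult algebra_simps intro!: exI[of _ "K + norm c * L"])
qed

lemma evaluation_in_bidual: "(\<lambda>f\<in>dual s. f x) \<in> bidual s"
proof -
  have "norm (f x) \<le> norm x * onorm f" if "f \<in> dual s" for f
    using onorm[of f x] that by (simp add: dual_def mult.commute)
  then show ?thesis
    by (auto simp: bidual_def dual_add dual_cmult intro!: exI[of _ "norm x"])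
qed

section \<open>Approximating bidual elements by points of the ball\<close>

text \<open>Polarization: the norm is multiplicative and induced by the inner product, so that
  multiplication by \<open>c\<close> is \<open>norm c\<close> times an isometry.\<close>

lemma inner_mult_mult_left:
  fixes c :: "'k::{real_normed_field, euclidean_space}"
  shows "inner (c * x) (c * y) = (norm c)\<^sup>2 * inner x y"
proof -
  have "inner u v = ((norm (u + v))\<^sup>2 - (norm u)\<^sup>2 - (norm v)\<^sup>2) / 2" for u v :: 'k
    by (simp add: power2_norm_eq_inner inner_add inner_commute)
  note P = this
  show ?thesis
    unfolding P[of "c * x"] P[of x]
    by (simp add: distrib_left[symmetric] norm_mult power_mult_distrib right_diff_distrib)
qed

text \<open>Here \<open>inner 1 z\<close> is the real part of \<open>z\<close>, and \<open>(norm r)\<^sup>2 *\<^sub>R inverse r\<close> is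
  the complex conjugate of \<open>r\<close>.\<close>

lemma inner_one_conj_mult:
  fixes r :: "'k::{real_normed_field, euclidean_space}"
  shows "inner 1 (((norm r)\<^sup>2 *\<^sub>R inverse r) * z) = inner r z"
proof (cases "r = 0")
  case False
  then show ?thesis
    using inner_mult_mult_left[of r 1 "inverse r * z"] by (simp add: mult.assoc[symmetric])
qed simp

lemma (in normed_space_over) onorm_le_if_real_part_le:
  assumes f: "f \<in> dual scale" and M: "\<And>y. norm y \<le> 1 \<Longrightarrow> inner 1 (f y) \<le> M"
  shows "onorm f \<le> M"
proof -
  interpret f: bounded_linear f using f by (simp add: dual_def)
  have "norm (f y) \<le> M" if y: "norm y \<le> 1" for y
  proof (cases "f y = 0")
    case True
    then show ?thesis using M[of 0] by simp
  next
    case False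
    \<comment> \<open>Rotating \<open>y\<close> makes \<open>f y\<close> real and positive.\<close>
    define c where "c = of_real (norm (f y)) / f y"
    have "norm (scale c y) \<le> 1"
      using False y by (simp add: norm_scale c_def norm_divide)
    moreover have "f (scale c y) = of_real (norm (f y))"
      using f False by (simp add: dual_def c_def)
    ultimately show ?thesis
      using M[of "scale c y"] by (simp add: of_real_def dot_square_norm)
  qed
  note N = this
  have "0 \<le> M" using N[of 0] by simp
  moreover have "norm (f y) \<le> M * norm y" for y
    using N[of "y /\<^sub>R norm y"] by (cases "y = 0") (auto simp: f.scaleR divide_simps)
  ultimately show ?thesis by (rule onorm_bound)
qed

text \<open>
  Goldstine's theorem by a variational argument. If it fails, the sum \<open>V x\<close> of the squared distances
  of \<open>\<phi> i x\<close> to \<open>\<Xi> (\<phi> i)\<close> has infimum \<open>d > 0\<close> over the ball. Let \<open>x\<close> almost attain it, with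
  residues \<open>r i\<close>, and let \<open>\<psi>\<close> be the sum of the \<open>\<phi> i\<close> with the conjugates of the \<open>r i\<close> as
  coefficients. Moving from \<open>x\<close> towards another point of the ball cannot reduce \<open>V\<close> below \<open>d\<close>, so
  the real part of \<open>\<psi>\<close> is almost maximal at \<open>x\<close>; hence \<open>onorm \<psi>\<close> almost equals the real part of
  \<open>\<psi> x\<close>. Since \<open>norm (\<Xi> \<psi>) \<le> onorm \<psi>\<close>, the real part of \<open>\<Xi> \<psi> - \<psi> x\<close> is less than \<open>d\<close>; but it
  equals \<open>V x \<ge> d\<close>.
\<close>

lemma (in normed_space_over) goldstine:
  assumes "finite I" and \<phi>: "\<And>i. i \<in> I \<Longrightarrow> \<phi> i \<in> dual scale"
    and \<Xi>: "\<Xi> \<in> bidual scale" and \<Xi>1: "\<And>f. f \<in> dual scale \<Longrightarrow> norm (\<Xi> f) \<le> onorm f"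
    and \<epsilon>: "0 < \<epsilon>"
  shows "\<exists>x. norm x \<le> 1 \<and> (\<forall>i\<in>I. norm (\<phi> i x - \<Xi> (\<phi> i)) < \<epsilon>)"
proof (rule ccontr)
  assume far: "\<not> ?thesis"
  define V where "V x = (\<Sum>i\<in>I. (norm (\<Xi> (\<phi> i) - \<phi> i x))\<^sup>2)" for x
  define B where "B = {x::'v. norm x \<le> 1}"
  define d where "d = Inf (V ` B)"
  have V_ge: "\<epsilon>\<^sup>2 \<le> V x" if "x \<in> B" for x
  proof -
    obtain i where i: "i \<in> I" "\<epsilon> \<le> norm (\<Xi> (\<phi> i) - \<phi> i x)"
      using far \<open>x \<in> B\<close> by (force simp: B_def norm_minus_commute)
    have "\<epsilon>\<^sup>2 \<le> (norm (\<Xi> (\<phi> i) - \<phi> i x))\<^sup>2" using i \<epsilon> by (intro power_mono) auto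
    also have "\<dots> \<le> V x"
      unfolding V_def using i \<open>finite I\<close> by (intro member_le_sum) auto
    finally show ?thesis .
  qed
  have ne: "V ` B \<noteq> {}" by (auto simp: B_def intro: exI[of _ 0])
  have "\<epsilon>\<^sup>2 \<le> d" unfolding d_def using V_ge ne by (intro cInf_greatest) auto
  then have d: "0 < d" using \<epsilon> by (smt (verit) zero_less_power)
  have d_le: "d \<le> V x" if "x \<in> B" for x
    unfolding d_def using V_ge that by (intro cInf_lower bdd_belowI[of _ "\<epsilon>\<^sup>2"]) auto
  define C where "C = (\<Sum>i\<in>I. (2 * onorm (\<phi> i))\<^sup>2)"
  have C: "0 \<le> C" unfolding C_def by (intro sum_nonneg) auto
  \<comment> \<open>The step length \<open>t\<close> and the excess \<open>d * t\<close> of \<open>V x\<close> are chosen so that the total error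
    \<open>d / 2 + t * C / 2\<close> below stays under \<open>d\<close>.\<close>
  define t where "t = d / (C + d + 1)"
  have t: "0 < t" "t \<le> 1" "t * C < d"
    using d C by (auto simp: t_def divide_simps algebra_simps add_pos_nonneg add_nonneg_pos)
  have "d < d + d * t" using d t by simp
  then obtain x where x: "x \<in> B" "V x < d + d * t"
    using cInf_lessD[OF ne, of "d + d * t", folded d_def] by auto
  define r where "r i = \<Xi> (\<phi> i) - \<phi> i x" for i
  have variation: "(\<Sum>i\<in>I. inner (r i) (\<phi> i y - \<phi> i x)) \<le> d / 2 + t * C / 2" if y: "y \<in> B" for y
  proof -
    define w where "w i = \<phi> i y - \<phi> i x" for i
    have "x + t *\<^sub>R (y - x) = (1 - t) *\<^sub>R x + t *\<^sub>R y" by (simp add: algebra_simps)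
    moreover have "norm ((1 - t) *\<^sub>R x + t *\<^sub>R y) \<le> (1 - t) * norm x + t * norm y"
      using t norm_triangle_ineq[of "(1 - t) *\<^sub>R x" "t *\<^sub>R y"] by simp
    moreover have "(1 - t) * norm x + t * norm y \<le> (1 - t) * 1 + t * 1"
      using t x y by (intro add_mono mult_left_mono) (auto simp: B_def)
    ultimately have "x + t *\<^sub>R (y - x) \<in> B" by (simp add: B_def)
    from d_le[OF this] have "d \<le> V (x + t *\<^sub>R (y - x))" .
    also have "V (x + t *\<^sub>R (y - x)) = (\<Sum>i\<in>I. (norm (r i - t *\<^sub>R w i))\<^sup>2)"
      unfolding V_def
    proof (rule sum.cong)
      fix i assume "i \<in> I"
      then interpret b: bounded_linear "\<phi> i" using \<phi> by (simp add: dual_def)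
      show "(norm (\<Xi> (\<phi> i) - \<phi> i (x + t *\<^sub>R (y - x))))\<^sup>2 = (norm (r i - t *\<^sub>R w i))\<^sup>2"
        by (simp add: r_def w_def b.add b.scaleR b.diff algebra_simps)
    qed simp
    also have "\<dots> = (\<Sum>i\<in>I. (norm (r i))\<^sup>2 - 2 * t * inner (r i) (w i) + t\<^sup>2 * (norm (w i))\<^sup>2)"
      by (intro sum.cong refl, unfold power2_norm_eq_inner)
        (simp add: inner_diff inner_commute power2_eq_square algebra_simps)
    also have "\<dots> = V x - 2 * t * (\<Sum>i\<in>I. inner (r i) (w i)) + t\<^sup>2 * (\<Sum>i\<in>I. (norm (w i))\<^sup>2)"
      by (simp add: sum.distrib sum_subtractf sum_distrib_left V_def r_def)
    also have "(\<Sum>i\<in>I. (norm (w i))\<^sup>2) \<le> C"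
      unfolding C_def
    proof (intro sum_mono power_mono)
      fix i assume "i \<in> I"
      then have b: "bounded_linear (\<phi> i)" using \<phi> by (simp add: dual_def)
      have "norm (\<phi> i z) \<le> onorm (\<phi> i)" if "z \<in> B" for z
        using onorm[OF b, of z] mult_left_mono[of "norm z" 1 "onorm (\<phi> i)"] onorm_pos_le[OF b] that
        by (simp add: B_def)
      from this[OF x(1)] this[OF y] show "norm (w i) \<le> 2 * onorm (\<phi> i)"
        unfolding w_def using norm_triangle_ineq4[of "\<phi> i y" "\<phi> i x"] by simp
    qed simp
    finally have "2 * t * (\<Sum>i\<in>I. inner (r i) (w i)) \<le> d * t + t\<^sup>2 * C"
      using x(2) by (simp add: mult_left_mono)
    then have "t * (\<Sum>i\<in>I. inner (r i) (w i)) \<le> t * (d / 2 + t * C / 2)"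
      by (simp add: algebra_simps power2_eq_square)
    then show ?thesis using t by (simp add: w_def)
  qed
  define k where "k i = (norm (r i))\<^sup>2 *\<^sub>R inverse (r i)" for i
  define \<psi> where "\<psi> = (\<lambda>z. \<Sum>i\<in>I. k i * \<phi> i z)"
  have \<psi>: "\<psi> \<in> dual scale" unfolding \<psi>_def by (rule dual_lincomb) (use assms in auto)
  have Re\<psi>: "inner 1 (\<psi> z) = (\<Sum>i\<in>I. inner (r i) (\<phi> i z))" for z
    by (simp only: \<psi>_def k_def inner_sum_right inner_one_conj_mult)
  have "onorm \<psi> \<le> inner 1 (\<psi> x) + (d / 2 + t * C / 2)"
  proof (rule onorm_le_if_real_part_le[OF \<psi>])
    fix y :: 'v assume "norm y \<le> 1"
    with variation[of y] show "inner 1 (\<psi> y) \<le> inner 1 (\<psi> x) + (d / 2 + t * C / 2)"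
      by (simp add: B_def Re\<psi> inner_diff_right sum_subtractf)
  qed
  moreover have "inner 1 (\<Xi> \<psi>) \<le> onorm \<psi>"
    using norm_cauchy_schwarz[of 1 "\<Xi> \<psi>"] \<Xi>1[OF \<psi>] by simp
  moreover have "inner 1 (\<Xi> \<psi>) = (\<Sum>i\<in>I. inner (r i) (\<Xi> (\<phi> i)))"
    using bidual_lincomb[OF \<Xi> \<open>finite I\<close> \<phi>, where c = k]
    by (simp only: \<psi>_def k_def inner_sum_right inner_one_conj_mult)
  moreover have "V x = (\<Sum>i\<in>I. inner (r i) (\<Xi> (\<phi> i))) - inner 1 (\<psi> x)"
    unfolding Re\<psi> V_def sum_subtractf[symmetric]
    by (simp add: r_def power2_norm_eq_inner inner_diff)
  ultimately have "V x \<le> d / 2 + t * C / 2" by linarith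
  then show False using d_le[OF x(1)] t by linarith
qed

section \<open>Weak-star continuous functionals are evaluations\<close>

text \<open>
  A functional that vanishes on the common kernel of finitely many functionals is a linear
  combination of them. The second hypothesis replaces a vector space structure on \<open>V\<close>: it asks for
  an element on which the functionals behave as on \<open>v - c w\<close>. This suits the bidual, which is not
  closed under the pointwise operations because its elements are \<open>undefined\<close> off the dual.
\<close>

lemma linear_combination_if_common_kernel:
  fixes p :: "'f \<Rightarrow> 'v \<Rightarrow> 'k::field" and L :: "'v \<Rightarrow> 'k"
  assumes "finite F"
    and "\<And>v w c. v \<in> V \<Longrightarrow> w \<in> V \<Longrightarrow>
           \<exists>u\<in>V. L u = L v - c * L w \<and> (\<forall>f\<in>F. p f u = p f v - c * p f w)"
    and "\<And>v. v \<in> V \<Longrightarrow> (\<forall>f\<in>F. p f v = 0) \<Longrightarrow> L v = 0"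
  shows "\<exists>c. \<forall>v\<in>V. L v = (\<Sum>f\<in>F. c f * p f v)"
  using assms
proof (induction F arbitrary: V rule: finite_induct)
  case empty
  then show ?case by simp
next
  case (insert g F)
  have "\<exists>c. \<forall>v\<in>{v \<in> V. p g v = 0}. L v = (\<Sum>f\<in>F. c f * p f v)"
  proof (rule insert.IH)
    fix v w c assume "v \<in> {v \<in> V. p g v = 0}" "w \<in> {v \<in> V. p g v = 0}"
    then show "\<exists>u\<in>{v \<in> V. p g v = 0}. L u = L v - c * L w \<and> (\<forall>f\<in>F. p f u = p f v - c * p f w)"
      using insert.prems(1)[of v w c] by auto
  next
    fix v assume "v \<in> {v \<in> V. p g v = 0}" "\<forall>f\<in>F. p f v = 0"
    then show "L v = 0" using insert.prems(2)[of v] by auto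
  qed
  then obtain c where c: "\<And>v. v \<in> V \<Longrightarrow> p g v = 0 \<Longrightarrow> L v = (\<Sum>f\<in>F. c f * p f v)" by auto
  show ?case
  proof (cases "\<forall>v\<in>V. p g v = 0")
    case True
    then show ?thesis using c insert.hyps by (auto intro!: exI[of _ c])
  next
    case False
    then obtain w where w: "w \<in> V" "p g w \<noteq> 0" by blast
    \<comment> \<open>The coefficient of \<open>g\<close> is fixed by the value of \<open>L\<close> at \<open>w\<close>; every \<open>v\<close> differs from a
      multiple of \<open>w\<close> by an element \<open>u\<close> of the kernel of \<open>g\<close>.\<close>
    define b where "b = (L w - (\<Sum>f\<in>F. c f * p f w)) / p g w"
    have "L v = b * p g v + (\<Sum>f\<in>F. c f * p f v)" if v: "v \<in> V" for v
    proof -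
      obtain u where u: "u \<in> V" "L u = L v - p g v / p g w * L w"
        "\<forall>f\<in>insert g F. p f u = p f v - p g v / p g w * p f w"
        using insert.prems(1)[OF v w(1), of "p g v / p g w"] by blast
      then have "L u = (\<Sum>f\<in>F. c f * p f u)" using w by (intro c) auto
      also have "\<dots> = (\<Sum>f\<in>F. c f * p f v - p g v / p g w * (c f * p f w))"
        using u(3) by (intro sum.cong refl) (simp only: insert_iff simp_thms right_diff_distrib mult.left_commute)
      also have "\<dots> = (\<Sum>f\<in>F. c f * p f v) - p g v / p g w * (\<Sum>f\<in>F. c f * p f w)"
        by (simp add: sum_subtractf sum_distrib_left)
      finally show ?thesis using u(2) w(2) by (simp add: b_def field_simps)
    qed
    moreover have "(\<Sum>f\<in>F. (c(g := b)) f * q f) = (\<Sum>f\<in>F. c f * q f)" for q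
      using insert.hyps by (intro sum.cong) auto
    ultimately show ?thesis
      using insert.hyps by (intro exI[of _ "c(g := b)"]) simp
  qed
qed

text \<open>
  A weak-star neighbourhood of 0 on which \<open>norm (L \<Phi>) < 1\<close> restricts \<open>\<Phi>\<close> at only finitely many
  \<open>f\<close>. On the subspace of those \<open>\<Phi>\<close> that vanish at all these \<open>f\<close> the functional \<open>L\<close> is therefore
  bounded by 1, hence zero, so that it is a combination of the evaluations at these \<open>f\<close>.
\<close>

lemma weak_star_continuous_functional_is_evaluation:
  fixes L :: "(('v::real_normed_vector \<Rightarrow> 'k::{real_normed_field, euclidean_space}) \<Rightarrow> 'k) \<Rightarrow> 'k"
  assumes cont: "continuous_map (weak_star_bidual_topology s) euclidean L"
    and lin: "\<And>\<Phi> \<Psi> c. \<Phi> \<in> bidual s \<Longrightarrow> \<Psi> \<in> bidual s \<Longrightarrow>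
                L (\<lambda>f\<in>dual s. \<Phi> f - c * \<Psi> f) = L \<Phi> - c * L \<Psi>"
  shows "\<exists>f\<in>dual s. \<forall>\<Phi>\<in>bidual s. L \<Phi> = \<Phi> f"
proof -
  define Z where "Z = (\<lambda>f\<in>dual s. 0 :: 'k)"
  have ev: "(\<lambda>f\<in>dual s. f 0) \<in> bidual s" by (rule evaluation_in_bidual)
  have Z_diff: "Z = (\<lambda>f\<in>dual s. (\<lambda>f\<in>dual s. f 0) f - 1 * (\<lambda>f\<in>dual s. f 0) f)"
    by (auto simp: Z_def)
  have Z: "Z \<in> bidual s" unfolding Z_diff by (rule bidual_diff_cmult[OF ev ev])
  have LZ: "L Z = 0" unfolding Z_diff lin[OF ev ev] by simp
  have "openin (weak_star_bidual_topology s) {\<Phi> \<in> bidual s. L \<Phi> \<in> ball 0 1}"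
    using openin_continuous_map_preimage[OF cont, of "ball 0 1"]
    by (simp add: weak_star_bidual_topology_def topspace_pairing_topology)
  then obtain W where W: "openin (product_topology (\<lambda>_. euclidean) (dual s)) W"
    "{\<Phi> \<in> bidual s. L \<Phi> \<in> ball 0 1} = (\<lambda>\<Phi>. \<lambda>f\<in>dual s. \<Phi> f) -` W \<inter> bidual s"
    by (auto simp: weak_star_bidual_topology_def pairing_topology_def openin_pullback_topology)
  have res: "(\<lambda>f\<in>dual s. \<Phi> f) = \<Phi>" if "\<Phi> \<in> bidual s" for \<Phi>
    using that by (auto simp: bidual_def extensional_restrict)
  have "Z \<in> W" using W(2) Z LZ res[OF Z] by force
  then obtain U where U: "finite {f \<in> dual s. U f \<noteq> UNIV}" "Z \<in> Pi\<^sub>E (dual s) U" "Pi\<^sub>E (dual s) U \<subseteq> W"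
    using W(1) unfolding openin_product_topology_alt by fastforce
  define F where "F = {f \<in> dual s. U f \<noteq> UNIV}"
  have F: "finite F" "F \<subseteq> dual s" using U by (auto simp: F_def)
  have small: "norm (L \<Phi>) < 1" if \<Phi>: "\<Phi> \<in> bidual s" "\<forall>f\<in>F. \<Phi> f = 0" for \<Phi>
  proof -
    have "\<Phi> f \<in> U f" if "f \<in> dual s" for f
      using U(2) \<Phi>(2) that by (cases "f \<in> F") (auto simp: F_def Z_def PiE_iff)
    then have "\<Phi> \<in> Pi\<^sub>E (dual s) U" using \<Phi>(1) by (auto simp: bidual_def PiE_iff)
    then have "\<Phi> \<in> (\<lambda>\<Phi>. \<lambda>f\<in>dual s. \<Phi> f) -` W \<inter> bidual s"
      using U(3) \<Phi>(1) res[OF \<Phi>(1)] by auto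
    then show ?thesis using W(2) by auto
  qed
  have "\<exists>c. \<forall>\<Phi>\<in>bidual s. L \<Phi> = (\<Sum>f\<in>F. c f * \<Phi> f)"
  proof (rule linear_combination_if_common_kernel[OF F(1)])
    fix \<Phi> \<Psi> c assume "\<Phi> \<in> bidual s" "\<Psi> \<in> bidual s"
    then show "\<exists>u\<in>bidual s. L u = L \<Phi> - c * L \<Psi> \<and> (\<forall>f\<in>F. u f = \<Phi> f - c * \<Psi> f)"
      using F(2) by (intro bexI[of _ "\<lambda>f\<in>dual s. \<Phi> f - c * \<Psi> f"])
        (auto simp: lin bidual_diff_cmult)
  next
    fix \<Phi> assume \<Phi>: "\<Phi> \<in> bidual s" "\<forall>f\<in>F. \<Phi> f = 0"
    show "L \<Phi> = 0"
    proof (rule ccontr)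
      assume "L \<Phi> \<noteq> 0"
      \<comment> \<open>The multiple of \<open>\<Phi>\<close> on which \<open>L\<close> takes the value 1 also vanishes on \<open>F\<close>.\<close>
      define u where "u = (\<lambda>f\<in>dual s. Z f - (- inverse (L \<Phi>)) * \<Phi> f)"
      have "L u = 1" unfolding u_def lin[OF Z \<Phi>(1)] using LZ \<open>L \<Phi> \<noteq> 0\<close> by simp
      moreover have "norm (L u) < 1"
        using F(2) \<Phi>(2) unfolding u_def
        by (intro small bidual_diff_cmult Z \<Phi>(1)) (auto simp: Z_def)
      ultimately show False by simp
    qed
  qed
  then obtain c where "\<forall>\<Phi>\<in>bidual s. L \<Phi> = (\<Sum>f\<in>F. c f * \<Phi> f)" ..
  moreover have "\<Phi> (\<lambda>x. \<Sum>f\<in>F. c f * f x) = (\<Sum>f\<in>F. c f * \<Phi> f)" if "\<Phi> \<in> bidual s" for \<Phi>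
    using bidual_lincomb[OF that F(1), of "\<lambda>f. f" c] F(2) by auto
  moreover have "(\<lambda>x. \<Sum>f\<in>F. c f * f x) \<in> dual s"
    using dual_lincomb[OF F(1), of "\<lambda>f. f" s c] F(2) by auto
  ultimately show ?thesis by (intro bexI[of _ "\<lambda>x. \<Sum>f\<in>F. c f * f x"]) auto
qed

section \<open>Compactness of the ball of the bidual\<close>

text \<open>
  The Banach-Alaoglu theorem: inside the product of the balls of radius \<open>onorm f\<close>, which is compact by
  Tychonoff's theorem, additivity and homogeneity are closed conditions.
\<close>

lemma compactin_bidual_ball:
  "compactin (product_topology (\<lambda>_. euclidean) (dual s))
     {\<Xi> \<in> bidual s. \<forall>f\<in>dual s. norm (\<Xi> f) \<le> onorm f}"
proof -
  let ?P = "product_topology (\<lambda>_. euclidean) (dual s) :: (('a \<Rightarrow> 'b) \<Rightarrow> 'b) topology"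
  have proj: "continuous_map ?P euclidean (\<lambda>u. u f)" if "f \<in> dual s" for f
    using that by (rule continuous_map_product_projection)
  have mult: "continuous_map ?P euclidean (\<lambda>u. c * u f)" if "f \<in> dual s" for f c
    using continuous_map_compose[OF proj[OF that], of euclidean "(*) c"]
    by (simp add: o_def continuous_on_mult_left)
  define K where "K = Pi\<^sub>E (dual s) (\<lambda>f. cball (0::'b) (onorm f))"
  have "compactin ?P K" unfolding K_def by (simp add: compactin_PiE)
  moreover define Add where "Add = (\<Inter>f\<in>dual s. \<Inter>g\<in>dual s.
      {u \<in> topspace ?P. u (\<lambda>x. f x + g x) - (u f + u g) \<in> {0}})"
  moreover define Scale where "Scale = (\<Inter>f\<in>dual s. \<Inter>c.
      {u \<in> topspace ?P. u (\<lambda>x. c * f x) - c * u f \<in> {0}})"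
  have ne: "dual s \<noteq> {}" using dual_lincomb[of "{}" "\<lambda>_. undefined" s] by auto
  have "closedin ?P Add" unfolding Add_def using ne
    by (intro closedin_INT closedin_continuous_map_preimage[where Y = euclidean]
        continuous_map_diff continuous_map_add proj dual_add) auto
  moreover have "closedin ?P Scale" unfolding Scale_def using ne
    by (intro closedin_INT closedin_continuous_map_preimage[where Y = euclidean]
        continuous_map_diff mult proj dual_cmult) auto
  ultimately have "compactin ?P (Add \<inter> (Scale \<inter> K))"
    by (intro closed_Int_compactin)
  moreover have "Add \<inter> (Scale \<inter> K) = {\<Xi> \<in> bidual s. \<forall>f\<in>dual s. norm (\<Xi> f) \<le> onorm f}"
    using ne by (auto simp: Add_def Scale_def K_def bidual_def PiE_iff extensional_def intro!: exI[of _ 1])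
  ultimately show ?thesis by simp
qed

lemma continuous_map_weak_dual_evaluation:
  assumes "\<Phi> \<in> bidual s"
  shows "continuous_map (weak_dual_topology s) euclidean (\<lambda>f. \<Phi> f)"
proof -
  have "continuous_map (weak_dual_topology s) (weak_dual_topology s) (\<lambda>f. f)" by simp
  with assms show ?thesis
    by (simp only: weak_dual_topology_def continuous_map_into_pairing_topology)
qed

lemma Hausdorff_weak_dual_topology: "Hausdorff_space (weak_dual_topology s)" (is "Hausdorff_space ?W")
  unfolding Hausdorff_space_def
proof (intro allI impI)
  fix f g assume fg: "f \<in> topspace (weak_dual_topology s) \<and> g \<in> topspace (weak_dual_topology s) \<and> f \<noteq> g"
  then have fg': "f \<in> dual s" "g \<in> dual s"
    by (auto simp: weak_dual_topology_def topspace_pairing_topology)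
  from fg obtain x where x: "f x \<noteq> g x" by blast
  then obtain U V where UV: "open U" "open V" "f x \<in> U" "g x \<in> V" "U \<inter> V = {}"
    by (metis hausdorff)
  have "continuous_map ?W euclidean (\<lambda>h. (\<lambda>f\<in>dual s. f x) h)"
    by (rule continuous_map_weak_dual_evaluation[OF evaluation_in_bidual])
  then have o: "openin ?W {h \<in> dual s. h x \<in> A}" if "open A" for A
    using openin_continuous_map_preimage[of ?W euclidean "\<lambda>h. (\<lambda>f\<in>dual s. f x) h" A] that
    by (simp add: weak_dual_topology_def topspace_pairing_topology cong: conj_cong)
  show "\<exists>U V. openin (weak_dual_topology s) U \<and> openin (weak_dual_topology s) V \<and>
              f \<in> U \<and> g \<in> V \<and> disjnt U V"
    using o[OF UV(1)] o[OF UV(2)] UV fg'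
    by (intro exI[of _ "{h \<in> dual s. h x \<in> U}"] exI[of _ "{h \<in> dual s. h x \<in> V}"])
      (auto simp: disjnt_def)
qed


section \<open>Gantmacher's theorem\<close>

text \<open>
  The weak topology of the dual is tested by the elements \<open>\<Xi>\<close> of the bidual, so the adjoint is
  continuous if and only if each of its compositions with a \<open>\<Xi>\<close> is weak-star continuous.
\<close>

lemma adjoint_weak_star_continuous_iff_represented:
  assumes T: "\<And>x. T x \<in> dual sY"
    and adj: "\<And>\<Phi>. \<Phi> \<in> bidual sY \<Longrightarrow> adjoint_to_dual T \<Phi> \<in> dual sX"
  shows "continuous_map (weak_star_bidual_topology sY) (weak_dual_topology sX) (adjoint_to_dual T)
     \<longleftrightarrow> (\<forall>\<Xi>\<in>bidual sX. \<exists>f\<in>dual sY. \<forall>\<Phi>\<in>bidual sY. \<Xi> (adjoint_to_dual T \<Phi>) = \<Phi> f)"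
    (is "continuous_map ?S ?W ?A \<longleftrightarrow> ?R")
proof -
  have "continuous_map ?S ?W ?A \<longleftrightarrow> (\<forall>\<Xi>\<in>bidual sX. continuous_map ?S euclidean (\<lambda>\<Phi>. \<Xi> (?A \<Phi>)))"
    using adj by (auto simp: weak_dual_topology_def continuous_map_into_pairing_topology
        weak_star_bidual_topology_def topspace_pairing_topology)
  also have "\<dots> \<longleftrightarrow> ?R"
  proof (intro ball_cong refl iffI)
    fix \<Xi> assume \<Xi>: "\<Xi> \<in> bidual sX" and cont: "continuous_map ?S euclidean (\<lambda>\<Phi>. \<Xi> (?A \<Phi>))"
    show "\<exists>f\<in>dual sY. \<forall>\<Phi>\<in>bidual sY. \<Xi> (?A \<Phi>) = \<Phi> f"
    proof (rule weak_star_continuous_functional_is_evaluation[OF cont])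
      fix \<Phi> \<Psi> c assume b: "\<Phi> \<in> bidual sY" "\<Psi> \<in> bidual sY"
      have "?A (\<lambda>f\<in>dual sY. \<Phi> f - c * \<Psi> f) = (\<lambda>x. ?A \<Phi> x + (- c) * ?A \<Psi> x)"
        using T by (auto simp: adjoint_to_dual_def)
      then show "\<Xi> (?A (\<lambda>f\<in>dual sY. \<Phi> f - c * \<Psi> f)) = \<Xi> (?A \<Phi>) - c * \<Xi> (?A \<Psi>)"
        by (simp only: bidual_add[OF \<Xi> adj[OF b(1)] dual_cmult[OF adj[OF b(2)]]]
            bidual_cmult[OF \<Xi> adj[OF b(2)]]) simp
    qed
  next
    fix \<Xi> assume "\<Xi> \<in> bidual sX" "\<exists>f\<in>dual sY. \<forall>\<Phi>\<in>bidual sY. \<Xi> (?A \<Phi>) = \<Phi> f"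
    then obtain f where f: "f \<in> dual sY" "\<And>\<Phi>. \<Phi> \<in> bidual sY \<Longrightarrow> \<Xi> (?A \<Phi>) = \<Phi> f" by blast
    have "continuous_map ?S ?S (\<lambda>\<Phi>. \<Phi>)" by simp
    then have "continuous_map ?S euclidean (\<lambda>\<Phi>. \<Phi> f)"
      using f(1) by (simp only: weak_star_bidual_topology_def continuous_map_into_pairing_topology)
    then show "continuous_map ?S euclidean (\<lambda>\<Phi>. \<Xi> (?A \<Phi>))"
      by (rule continuous_map_eq)
        (simp add: f weak_star_bidual_topology_def topspace_pairing_topology)
  qed
  finally show ?thesis .
qed

text \<open>
  After scaling \<open>\<Xi>\<close> to an element \<open>Z\<close> of the unit ball, consider the conditions
  \<open>norm (Z (adjoint_to_dual T \<Phi>) - \<Phi> f) \<le> \<epsilon>\<close> on \<open>f\<close>. They are weakly closed, and Goldstine's theorem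
  satisfies finitely many of them by some \<open>T x\<close> with \<open>x\<close> in the unit ball; compactness then
  satisfies all of them.
\<close>

lemma (in normed_space_over) represented_if_relatively_weakly_compact:
  assumes T: "\<And>x. T x \<in> dual sY"
    and adj: "\<And>\<Phi>. \<Phi> \<in> bidual sY \<Longrightarrow> adjoint_to_dual T \<Phi> \<in> dual scale"
    and compact: "relatively_compactin (weak_dual_topology sY) (T ` {x. norm x \<le> 1})"
    and \<Xi>: "\<Xi> \<in> bidual scale"
  shows "\<exists>f\<in>dual sY. \<forall>\<Phi>\<in>bidual sY. \<Xi> (adjoint_to_dual T \<Phi>) = \<Phi> f"
proof -
  let ?W = "weak_dual_topology sY"
  let ?A = "adjoint_to_dual T"
  let ?TB = "T ` {x. norm x \<le> 1}"
  have top: "topspace ?W = dual sY"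
    by (simp add: weak_dual_topology_def topspace_pairing_topology)
  obtain K where K: "\<And>f. f \<in> dual scale \<Longrightarrow> norm (\<Xi> f) \<le> K * onorm f"
    using \<Xi> unfolding bidual_def by blast
  define c :: 'k where "c = of_real (\<bar>K\<bar> + 1)"
  have norm_c: "norm c = \<bar>K\<bar> + 1" by (simp add: c_def)
  then have c: "c \<noteq> 0" by auto
  \<comment> \<open>\<open>Z\<close> is \<open>\<Xi>\<close> divided by \<open>c\<close>, written as a difference so that \<open>bidual_diff_cmult\<close> applies.\<close>
  define Z where "Z = (\<lambda>f\<in>dual scale. \<Xi> f - (1 - inverse c) * \<Xi> f)"
  have Z: "Z \<in> bidual scale" unfolding Z_def by (rule bidual_diff_cmult[OF \<Xi> \<Xi>])
  have Z_eq: "Z f = inverse c * \<Xi> f" if "f \<in> dual scale" for f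
    using that by (simp add: Z_def algebra_simps)
  have Z1: "norm (Z f) \<le> onorm f" if f: "f \<in> dual scale" for f
  proof -
    have "0 \<le> onorm f" using f by (auto simp: dual_def intro: onorm_pos_le)
    then have "K * onorm f \<le> (\<bar>K\<bar> + 1) * onorm f" by (intro mult_right_mono) auto
    with K[OF f] have "norm (\<Xi> f) \<le> norm c * onorm f" by (simp add: norm_c)
    then show ?thesis using c by (simp add: Z_eq[OF f] norm_divide divide_simps mult.commute)
  qed
  define C where "C = (\<lambda>(\<Phi>, \<epsilon>). {f \<in> dual sY. \<Phi> f \<in> cball (Z (?A \<Phi>)) \<epsilon>})"
  let ?I = "bidual sY \<times> {0<..}"
  have closed: "closedin ?W D" if "D \<in> C ` ?I" for D
    using that closedin_continuous_map_preimage[OF continuous_map_weak_dual_evaluation]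
    by (force simp: C_def top simp flip: closed_closedin)
  have fip: "?W closure_of ?TB \<inter> \<Inter>\<F> \<noteq> {}" if \<F>: "finite \<F>" "\<F> \<subseteq> C ` ?I" for \<F>
  proof -
    obtain P where P: "finite P" "P \<subseteq> ?I" "\<F> = C ` P"
      using finite_subset_image[OF \<F>] by auto
    define \<epsilon> where "\<epsilon> = Min (insert 1 (snd ` P))"
    have \<epsilon>: "0 < \<epsilon>" "\<And>p. p \<in> P \<Longrightarrow> \<epsilon> \<le> snd p"
      using P by (auto simp: \<epsilon>_def)
    have "\<exists>x. norm x \<le> 1 \<and> (\<forall>p\<in>P. norm (?A (fst p) x - Z (?A (fst p))) < \<epsilon>)"
      using P(2) by (intro goldstine[OF P(1) _ Z Z1 \<epsilon>(1)] adj) auto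
    then obtain x where x: "norm x \<le> 1" "\<And>p. p \<in> P \<Longrightarrow> norm (?A (fst p) x - Z (?A (fst p))) < \<epsilon>"
      by blast
    have "T x \<in> C p" if "p \<in> P" for p
      using T x(2)[OF that] \<epsilon>(2)[OF that]
      by (auto simp: C_def adjoint_to_dual_def dist_norm norm_minus_commute split: prod.split)
    moreover have "T x \<in> ?W closure_of ?TB"
      using closure_of_subset[of ?TB ?W] T x(1) by (auto simp: top)
    ultimately show ?thesis using P(3) by auto
  qed
  have "?W closure_of ?TB \<inter> \<Inter>(C ` ?I) \<noteq> {}"
    using compact closed fip unfolding relatively_compactin_def compactin_fip by metis
  then obtain f where f: "\<And>p. p \<in> ?I \<Longrightarrow> f \<in> C p" by blast
  have "(\<lambda>f\<in>dual sY. f 0) \<in> bidual sY" by (rule evaluation_in_bidual)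
  with f[of "(\<lambda>f\<in>dual sY. f 0, 1)"] have fd: "f \<in> dual sY" by (auto simp: C_def)
  have "\<Phi> f = Z (?A \<Phi>)" if "\<Phi> \<in> bidual sY" for \<Phi>
  proof -
    have "dist (Z (?A \<Phi>)) (\<Phi> f) \<le> 0 + \<epsilon>" if "0 < \<epsilon>" for \<epsilon>
      using f[of "(\<Phi>, \<epsilon>)"] \<open>\<Phi> \<in> bidual sY\<close> that by (auto simp: C_def)
    then have "dist (Z (?A \<Phi>)) (\<Phi> f) \<le> 0" by (rule field_le_epsilon)
    then show ?thesis by simp
  qed
  note Z_rep = this
  have "\<Xi> (?A \<Phi>) = \<Phi> (\<lambda>y. c * f y)" if \<Phi>: "\<Phi> \<in> bidual sY" for \<Phi>
    using c by (simp add: bidual_cmult[OF \<Phi> fd] Z_rep[OF \<Phi>] Z_eq[OF adj[OF \<Phi>]])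
  then show ?thesis using dual_cmult[OF fd] by blast
qed

text \<open>
  The representing map \<open>S\<close> is the second adjoint of \<open>T\<close>, with values in the dual of \<open>Y\<close> instead of
  its third dual. It extends \<open>T\<close>, so the image of the ball under \<open>T\<close> lies in the compact image of
  the ball of the bidual.
\<close>

lemma relatively_weakly_compact_if_represented:
  assumes T: "\<And>x. T x \<in> dual sY"
    and adj: "\<And>\<Phi>. \<Phi> \<in> bidual sY \<Longrightarrow> adjoint_to_dual T \<Phi> \<in> dual sX"
    and rep: "\<And>\<Xi>. \<Xi> \<in> bidual sX \<Longrightarrow>
                \<exists>f\<in>dual sY. \<forall>\<Phi>\<in>bidual sY. \<Xi> (adjoint_to_dual T \<Phi>) = \<Phi> f"
  shows "relatively_compactin (weak_dual_topology sY) (T ` {x. norm x \<le> 1})"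
proof -
  let ?W = "weak_dual_topology sY"
  let ?A = "adjoint_to_dual T"
  let ?P = "product_topology (\<lambda>_. euclidean) (dual sX)"
  let ?TB = "T ` {x. norm x \<le> 1}"
  have top: "topspace ?W = dual sY"
    by (simp add: weak_dual_topology_def topspace_pairing_topology)
  define D where "D = {\<Xi> \<in> bidual sX. \<forall>f\<in>dual sX. norm (\<Xi> f) \<le> onorm f}"
  obtain S where S: "\<And>\<Xi>. \<Xi> \<in> bidual sX \<Longrightarrow> S \<Xi> \<in> dual sY"
    "\<And>\<Xi> \<Phi>. \<Xi> \<in> bidual sX \<Longrightarrow> \<Phi> \<in> bidual sY \<Longrightarrow> \<Xi> (?A \<Phi>) = \<Phi> (S \<Xi>)"
    using rep by metis
  have "continuous_map (subtopology ?P D) ?W S"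
    unfolding weak_dual_topology_def continuous_map_into_pairing_topology
  proof (intro conjI ballI)
    show "S ` topspace (subtopology ?P D) \<subseteq> dual sY" using S(1) by (auto simp: D_def)
    fix \<Phi> assume \<Phi>: "\<Phi> \<in> bidual sY"
    have "continuous_map (subtopology ?P D) euclidean (\<lambda>\<Xi>. \<Xi> (?A \<Phi>))"
      by (intro continuous_map_from_subtopology continuous_map_product_projection adj \<Phi>)
    then show "continuous_map (subtopology ?P D) euclidean (\<lambda>\<Xi>. \<Phi> (S \<Xi>))"
      by (rule continuous_map_eq) (simp add: D_def S(2) \<Phi>)
  qed
  moreover have "compactin (subtopology ?P D) D"
    using compactin_bidual_ball[of sX] by (simp add: compactin_subtopology D_def)
  ultimately have compact: "compactin ?W (S ` D)" by (rule image_compactin[rotated])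
  have "T x \<in> S ` D" if x: "norm x \<le> 1" for x
  proof -
    define J where "J = (\<lambda>g\<in>dual sX. g x)"
    have J: "J \<in> bidual sX" unfolding J_def by (rule evaluation_in_bidual)
    have "norm (g x) \<le> onorm g" if "g \<in> dual sX" for g
    proof -
      have g: "bounded_linear g" using that by (simp add: dual_def)
      then show ?thesis
        using onorm[OF g, of x] mult_left_mono[OF x onorm_pos_le[OF g]] by simp
    qed
    then have "J \<in> D" using J by (simp add: D_def J_def)
    moreover have "S J = T x"
    proof
      fix y
      \<comment> \<open>Evaluations separate the points of the dual, so it is enough to test the representation
        of \<open>J\<close> on them.\<close>
      have E: "(\<lambda>f\<in>dual sY. f y) \<in> bidual sY" by (rule evaluation_in_bidual)
      have "S J y = (\<lambda>f\<in>dual sY. f y) (S J)" using S(1)[OF J] by simp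
      also have "\<dots> = J (?A (\<lambda>f\<in>dual sY. f y))" using S(2)[OF J E] by simp
      also have "\<dots> = T x y" using adj[OF E] T by (simp add: J_def adjoint_to_dual_def)
      finally show "S J y = T x y" .
    qed
    ultimately show ?thesis by force
  qed
  then have sub: "?TB \<subseteq> S ` D" by auto
  have "closedin ?W (S ` D)"
    using compactin_imp_closedin[OF Hausdorff_weak_dual_topology compact] .
  then have "?W closure_of ?TB \<subseteq> S ` D" by (intro closure_of_minimal sub)
  then have "compactin ?W (?W closure_of ?TB)"
    by (rule closed_compactin[OF compact _ closedin_closure_of])
  then show ?thesis using T by (auto simp: relatively_compactin_def top)
qed

theorem gantmacher:
  assumes "normed_space_over sX" and m: "bounded_bilinear_over sX sY sZ m" and z': "z' \<in> dual sZ"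
  shows "relatively_compactin (weak_dual_topology sY) (bilinear_adjoint m z' ` {x. norm x \<le> 1})
     \<longleftrightarrow> continuous_map (weak_star_bidual_topology sY) (weak_dual_topology sX)
           (adjoint_to_dual (bilinear_adjoint m z'))"
proof -
  interpret normed_space_over sX by fact
  let ?T = "bilinear_adjoint m z'"
  have T: "?T x \<in> dual sY" for x
    by (rule bilinear_adjoint_in_dual[OF m z'])
  have adj: "adjoint_to_dual ?T \<Phi> \<in> dual sX" if "\<Phi> \<in> bidual sY" for \<Phi>
    by (rule adjoint_to_dual_in_dual[OF m z' that])
  have "continuous_map (weak_star_bidual_topology sY) (weak_dual_topology sX) (adjoint_to_dual ?T)
      \<longleftrightarrow> (\<forall>\<Xi>\<in>bidual sX. \<exists>f\<in>dual sY. \<forall>\<Phi>\<in>bidual sY. \<Xi> (adjoint_to_dual ?T \<Phi>) = \<Phi> f)"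
    by (rule adjoint_weak_star_continuous_iff_represented[OF T adj])
  also have "\<dots> \<longleftrightarrow> relatively_compactin (weak_dual_topology sY) (?T ` {x. norm x \<le> 1})"
    using represented_if_relatively_weakly_compact[of ?T, OF T]
      relatively_weakly_compact_if_represented[of ?T, OF T] adj
    by blast
  finally show ?thesis by (rule sym)
qed

theorem mainTheorem4:
  fixes sA :: "'k::{real_normed_field, euclidean_space} \<Rightarrow> 'a::{real_normed_algebra, banach} \<Rightarrow> 'a"
    and sB :: "'k \<Rightarrow> 'b::banach \<Rightarrow> 'b"
  assumes "normed_algebra_over sA" and "normed_space_over sB"
  shows "(\<forall>(\<pi>l :: 'a \<Rightarrow> 'b \<Rightarrow> 'b) b'.
            left_banach_module sA sB \<pi>l \<longrightarrow> b' \<in> dual sB \<longrightarrow>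
            (b' \<in> wap_left sB \<pi>l \<longleftrightarrow>
             continuous_map (weak_star_bidual_topology sB) (weak_dual_topology sA)
               (adjoint_to_dual (bilinear_adjoint \<pi>l b'))))
       \<and> (\<forall>(\<pi>r :: 'b \<Rightarrow> 'a \<Rightarrow> 'b) b'.
            right_banach_module sA sB \<pi>r \<longrightarrow> b' \<in> dual sB \<longrightarrow>
            (b' \<in> wap_right sA sB \<pi>r \<longleftrightarrow>
             continuous_map (weak_star_bidual_topology sA) (weak_dual_topology sB)
               (adjoint_to_dual (bilinear_adjoint \<pi>r b'))))"
proof (intro conjI allI impI)
  fix \<pi>l :: "'a \<Rightarrow> 'b \<Rightarrow> 'b" and b'
  assume "left_banach_module sA sB \<pi>l" and b': "b' \<in> dual sB"
  then interpret left_banach_module sA sB \<pi>l by simp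
  show "b' \<in> wap_left sB \<pi>l \<longleftrightarrow>
      continuous_map (weak_star_bidual_topology sB) (weak_dual_topology sA)
        (adjoint_to_dual (bilinear_adjoint \<pi>l b'))"
    using gantmacher[OF A.normed_space_over_axioms bilinear_action b'] b' by (simp add: wap_left_def)
next
  fix \<pi>r :: "'b \<Rightarrow> 'a \<Rightarrow> 'b" and b'
  assume "right_banach_module sA sB \<pi>r" and b': "b' \<in> dual sB"
  then interpret right_banach_module sA sB \<pi>r by simp
  show "b' \<in> wap_right sA sB \<pi>r \<longleftrightarrow>
      continuous_map (weak_star_bidual_topology sA) (weak_dual_topology sB)
        (adjoint_to_dual (bilinear_adjoint \<pi>r b'))"
    using gantmacher[OF B.normed_space_over_axioms bilinear_action b'] b' by (simp add: wap_right_def)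
qed

end
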